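(* Let $\mathcal{H}$ be a separable complex Hilbert space and let $P\in\mathcal{B}(\mathcal{H})$ be a bounded idempotent ($P^2=P$, not necessarily self-adjoint). Consider the set $\{J\in\mathcal{B}(\mathcal{H}): P^{\ast}JP\leqslant J,\ J=J^{\ast}=J^{-1}\}$ with the Loewner partial order. Then this set has a minimum and a maximum, given by (i) $\min\{J: P^{\ast}JP\leqslant J,\ J=J^{\ast}=J^{-1}\}=2P_{(P+P^{\ast})^{-}}-I+2P_{N(P+P^{\ast})}$; (ii) $\max\{J: P^{\ast}JP\leqslant J,\ J=J^{\ast}=J^{-1}\}=2P_{(P+P^{\ast})^{-}}-I+2P_{N(P-P^{\ast})}$.
   Context: For self-adjoint operators, $A\geqslant B$ (Loewner order) means $\langle (A-B)x,x\rangle\geqslant 0$ for all $x$. The min (max) of a set of self-adjoint operators is an element of the set that is $\leqslant$ (respectively $\geqslant$) every element of the set in the Loewner order. For self-adjoint $A$, $A^{+}=\frac{|A|+A}{2}$ and $A^{-}=\frac{|A|-A}{2}$. $N(T)$ and $R(T)$ denote the null space and range of $T$. For a closed subspace $\mathcal{M}$, $P_{\mathcal{M}}$ is the orthogonal projection onto $\mathcal{M}$; for an operator $A$, $P_A$ is the orthogonal projection onto $\overline{R(A)}$. *)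

theory Defs
  imports "HOL-Analysis.Analysis"
begin

class complex_vector = real_vector +
  fixes scaleC :: "complex \<Rightarrow> 'a \<Rightarrow> 'a"  (infixr "*\<^sub>C" 75)
  assumes scaleC_add_right: "a *\<^sub>C (x + y) = a *\<^sub>C x + a *\<^sub>C y"
    and scaleC_add_left: "(a + b) *\<^sub>C x = a *\<^sub>C x + b *\<^sub>C x"
    and scaleC_scaleC: "a *\<^sub>C (b *\<^sub>C x) = (a * b) *\<^sub>C x"
    and scaleC_one: "1 *\<^sub>C x = x"
    and scaleR_scaleC: "r *\<^sub>R x = complex_of_real r *\<^sub>C x"

text \<open>
  The complex inner product is linear in its first argument. Its real part is the inner product
  of the underlying real space, so positive definiteness and the fact that the norm is
  \<open>sqrt (cinner x x)\<close> are inherited from \<^class>\<open>real_inner\<close>.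
\<close>

class complex_inner = complex_vector + real_inner +
  fixes cinner :: "'a \<Rightarrow> 'a \<Rightarrow> complex"
  assumes cinner_commute: "cinner x y = cnj (cinner y x)"
    and cinner_add_left: "cinner (x + y) z = cinner x z + cinner y z"
    and cinner_scaleC_left: "cinner (c *\<^sub>C x) y = c * cinner x y"
    and Re_cinner: "Re (cinner x y) = inner x y"

class chilbert_space = complex_inner + complete_space

instantiation complex :: chilbert_space
begin

definition scaleC_complex :: "complex \<Rightarrow> complex \<Rightarrow> complex"
  where "scaleC_complex c x = c * x"

definition cinner_complex :: "complex \<Rightarrow> complex \<Rightarrow> complex"
  where "cinner_complex x y = x * cnj y"

instance
  by standard
    (simp_all add: scaleC_complex_def cinner_complex_def inner_complex_def algebra_simps
      scaleR_conv_of_real)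

end

definition bounded_clinear :: "('a::chilbert_space \<Rightarrow> 'a) \<Rightarrow> bool"
  where "bounded_clinear A \<longleftrightarrow> bounded_linear A \<and> (\<forall>c x. A (c *\<^sub>C x) = c *\<^sub>C A x)"

definition adj :: "('a::chilbert_space \<Rightarrow> 'a) \<Rightarrow> 'a \<Rightarrow> 'a"
  where "adj A = (THE B. bounded_clinear B \<and> (\<forall>x y. cinner (A x) y = cinner x (B y)))"

text \<open>\<open>\<real>\<^sub>\<ge>\<^sub>0\<close> is taken in \<^typ>\<open>complex\<close>: the quadratic form is real and nonnegative.\<close>

definition loewner_le :: "('a::chilbert_space \<Rightarrow> 'a) \<Rightarrow> ('a \<Rightarrow> 'a) \<Rightarrow> bool"  (infix "\<le>\<^sub>L" 50)
  where "A \<le>\<^sub>L B \<longleftrightarrow> (\<forall>x. cinner (B x - A x) x \<in> \<real>\<^sub>\<ge>\<^sub>0)"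

definition loewner_min :: "('a::chilbert_space \<Rightarrow> 'a) set \<Rightarrow> ('a \<Rightarrow> 'a) \<Rightarrow> bool"
  where "loewner_min S M \<longleftrightarrow> M \<in> S \<and> (\<forall>J\<in>S. M \<le>\<^sub>L J)"

definition loewner_max :: "('a::chilbert_space \<Rightarrow> 'a) set \<Rightarrow> ('a \<Rightarrow> 'a) \<Rightarrow> bool"
  where "loewner_max S M \<longleftrightarrow> M \<in> S \<and> (\<forall>J\<in>S. J \<le>\<^sub>L M)"

definition op_abs :: "('a::chilbert_space \<Rightarrow> 'a) \<Rightarrow> 'a \<Rightarrow> 'a"
  where "op_abs A = (THE B. bounded_clinear B \<and> (\<lambda>x. 0) \<le>\<^sub>L B \<and> B \<circ> B = adj A \<circ> A)"

definition neg_part :: "('a::chilbert_space \<Rightarrow> 'a) \<Rightarrow> 'a \<Rightarrow> 'a"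
  where "neg_part A = (\<lambda>x. (op_abs A x - A x) /\<^sub>R 2)"

definition null_space :: "('a::chilbert_space \<Rightarrow> 'a) \<Rightarrow> 'a set"
  where "null_space A = {x. A x = 0}"

definition orth_proj :: "'a::chilbert_space set \<Rightarrow> 'a \<Rightarrow> 'a"
  where "orth_proj M x = (THE y. y \<in> M \<and> (\<forall>z\<in>M. cinner (x - y) z = 0))"

definition range_proj :: "('a::chilbert_space \<Rightarrow> 'a) \<Rightarrow> 'a \<Rightarrow> 'a"
  where "range_proj A = orth_proj (closure (range A))"

text \<open>
  \<open>J = adj J = inverse of J\<close>. Bijectivity is explicit because \<^const>\<open>inv\<close> is total; the inverse,
  being \<open>J\<close>, is automatically bounded.
\<close>

definition symmetry :: "('a::chilbert_space \<Rightarrow> 'a) \<Rightarrow> bool"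
  where "symmetry J \<longleftrightarrow> bounded_clinear J \<and> J = adj J \<and> bij J \<and> J = inv J"

end

theory Submission
  imports Defs
begin

text \<open>
  Write \<open>A = P + P\<^sup>*\<close>. A symmetry \<open>J\<close> satisfies \<open>P\<^sup>* J P \<le> J\<close> iff \<open>J P = P\<^sup>* J\<close> and \<open>J (I - P) \<ge> 0\<close>.
  Such a \<open>J\<close> commutes with \<open>2I - A\<close> and \<open>J (2I - A) \<ge> 0\<close> squares to \<open>(2I - A)\<^sup>2\<close>, so
  \<open>J (2I - A) = \<bar>2I - A\<bar>\<close> is the same for all of them: they differ only on
  \<open>N(2I - A) = R(P) \<inter> R(P\<^sup>*)\<close>, a reducing subspace on which \<open>J\<close> may be any symmetry. The extreme
  choices there are \<open>- I\<close> and \<open>I\<close>. The existence of one such \<open>J\<close> comes from the sign of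
  \<open>F = A - I\<close>: the minimum is \<open>- F (F\<^sup>2)\<^sup>-\<^sup>1\<^sup>/\<^sup>2\<close>. It equals \<open>I\<close> on \<open>N(A)\<close> and satisfies
  \<open>\<bar>A\<bar> = - J A\<close>, which identifies it with the expression in terms of \<open>A\<^sup>-\<close>; finally
  \<open>N(P - P\<^sup>*)\<close> is the orthogonal sum of \<open>N(A)\<close> and \<open>R(P) \<inter> R(P\<^sup>*)\<close>.
\<close>

section \<open>Real Hilbert spaces\<close>

instance chilbert_space \<subseteq> banach ..

section \<open>Variational arguments and operator square roots\<close>

text \<open>For small \<open>t\<close> of sign opposite to \<open>b\<close> the linear term would
  dominate; \<open>t = - b / c\<close> with \<open>c = \<bar>a\<bar> + 1\<close> is small
  enough.\<close>

lemma linear_term_eq_0: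
  fixes a b :: real
  assumes "\<And>t. 0 \<le> 2 * t * b + t\<^sup>2 * a"
  shows "b = 0"
proof (rule ccontr)
  assume b: "b \<noteq> 0"
  define c where "c = \<bar>a\<bar> + 1"
  have c: "c > 0" "a < c" by (auto simp: c_def)
  have "2 * (- b / c) * b + (- b / c)\<^sup>2 * a = - (b\<^sup>2 / c) * (2 - a / c)"
    using c by (simp add: field_simps power2_eq_square)
  moreover have "b\<^sup>2 / c > 0" "2 - a / c > 0"
    using b c by (simp_all add: field_simps)
  ultimately show False
    using assms[of "- b / c"] by (smt (verit) mult_minus_left mult_pos_pos)
qed

text \<open>\<open>y\<close> minimises \<open>norm x ^ 2 - 2 * f x\<close> over \<open>M\<close>,
  and the first variation at \<open>y\<close> is the claim. \<open>M = UNIV\<close> yields adjoints,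
  \<open>f = inner x\<close> orthogonal projections.\<close>

lemma riesz_on_closed_subspace:
  fixes f :: "'a::{real_inner,banach} \<Rightarrow> real"
  assumes M: "subspace M" "closed M" and f: "bounded_linear f"
  shows "\<exists>y\<in>M. \<forall>z\<in>M. f z = inner y z"
proof -
  interpret f: bounded_linear f by (rule f)
  obtain c where c: "\<And>x. \<bar>f x\<bar> \<le> norm x * c"
    using f.bounded by auto
  define \<phi> where "\<phi> x = (norm x)\<^sup>2 - 2 * f x" for x
  define m where "m = Inf (\<phi> ` M)"
  have low: "- c\<^sup>2 \<le> \<phi> x" for x
  proof -
    have "0 \<le> (norm x - c)\<^sup>2" by simp
    then show ?thesis using c[of x] by (simp add: \<phi>_def power2_diff)
  qed
  have bdd: "bdd_below (\<phi> ` M)" using low by (auto intro!: bdd_belowI2)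
  have "0 \<in> M" using M(1) by (rule subspace_0)
  have m_le: "m \<le> \<phi> x" if "x \<in> M" for x
    unfolding m_def using that bdd by (rule cINF_lower[rotated])
  have "\<exists>x\<in>M. \<phi> x < m + 1 / real (Suc n)" for n
    using cInf_lessD[of "\<phi> ` M" "m + 1 / real (Suc n)"] \<open>0 \<in> M\<close> by (auto simp: m_def)
  then obtain X where X: "\<And>n. X n \<in> M" "\<And>n. \<phi> (X n) < m + 1 / real (Suc n)"
    by metis
  \<comment> \<open>Parallelogram law; the linear part of \<open>\<phi>\<close> cancels at the
    midpoint. Near-minimisers are therefore close to each other, since \<open>\<phi>\<close> is at
    least \<open>m\<close> at their midpoint.\<close>
  have par: "(norm (x - y))\<^sup>2 = 2 * (\<phi> x + \<phi> y - 2 * \<phi> ((1/2) *\<^sub>R (x + y)))" for x y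
    by (simp add: \<phi>_def f.add f.scaleR power2_norm_eq_inner inner_simps inner_commute field_simps)
  have close: "(norm (X i - X j))\<^sup>2 \<le> 4 / real (Suc n)" if "i \<ge> n" "j \<ge> n" for i j n
  proof -
    have "(1/2) *\<^sub>R (X i + X j) \<in> M"
      using M(1) X(1) by (intro subspace_scale subspace_add)
    then have "m \<le> \<phi> ((1/2) *\<^sub>R (X i + X j))" by (rule m_le)
    moreover have "1 / real (Suc i) \<le> 1 / real (Suc n)" "1 / real (Suc j) \<le> 1 / real (Suc n)"
      using that by (auto intro!: divide_left_mono)
    moreover have "4 / real (Suc n) = 4 * (1 / real (Suc n))" by simp
    ultimately show ?thesis
      using par[of "X i" "X j"] X(2)[of i] X(2)[of j] by argo
  qed
  have "Cauchy X"
  proof (rule metric_CauchyI)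
    fix e :: real assume e: "e > 0"
    obtain n where "4 / e\<^sup>2 < real n" using reals_Archimedean2 by blast
    then have "4 / e\<^sup>2 < real (Suc n)" by simp
    then have n: "4 / real (Suc n) < e\<^sup>2" using e by (simp add: field_simps)
    have "dist (X i) (X j) < e" if "i \<ge> n" "j \<ge> n" for i j
    proof -
      have "(norm (X i - X j))\<^sup>2 < e\<^sup>2"
        using close[OF that] n by linarith
      then show ?thesis using e by (simp add: dist_norm power_less_imp_less_base)
    qed
    then show "\<exists>N. \<forall>m\<ge>N. \<forall>n\<ge>N. dist (X m) (X n) < e" by blast
  qed
  then obtain y where y: "X \<longlonglongrightarrow> y" using Cauchy_convergent convergent_def by blast
  then have yM: "y \<in> M" using M(2) X(1) closed_sequentially by blast
  have "(\<lambda>n. \<phi> (X n)) \<longlonglongrightarrow> \<phi> y"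
    unfolding \<phi>_def by (intro tendsto_intros y f.tendsto)
  moreover have "(\<lambda>n. m + 1 / real (Suc n)) \<longlonglongrightarrow> m + 0"
    by (intro tendsto_intros LIMSEQ_Suc lim_1_over_n)
  ultimately have y_min: "\<phi> y \<le> m"
    using X(2) by (intro LIMSEQ_le) (auto intro: less_imp_le)
  have "f z = inner y z" if z: "z \<in> M" for z
  proof -
    have "inner y z - f z = 0"
    proof (rule linear_term_eq_0)
      fix t :: real
      have "y + t *\<^sub>R z \<in> M" using M(1) yM z by (intro subspace_scale subspace_add)
      then have "\<phi> y \<le> \<phi> (y + t *\<^sub>R z)" using y_min m_le by force
      then show "0 \<le> 2 * t * (inner y z - f z) + t\<^sup>2 * inner z z"
        unfolding \<phi>_def power2_norm_eq_inner
        by (simp add: f.add f.scaleR inner_simps inner_commute power2_eq_square algebra_simps)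
    qed
    then show ?thesis by simp
  qed
  with yM show ?thesis by blast
qed

text \<open>Perturbing \<open>x\<close> in the direction \<open>A x\<close> gives a nonnegative
  quadratic in \<open>t\<close> without constant term, whose linear coefficient is twice the squared
  norm of \<open>A x\<close>.\<close>

lemma positive_form_eq_0:
  fixes A :: "'a::real_inner \<Rightarrow> 'a"
  assumes "linear A" and sa: "\<And>x y. inner (A x) y = inner x (A y)"
    and pos: "\<And>x. 0 \<le> inner (A x) x" and 0: "inner (A x) x = 0"
  shows "A x = 0"
proof -
  interpret L: linear A by fact
  have "inner (A x) (A x) = 0"
  proof (rule linear_term_eq_0)
    fix t :: real
    show "0 \<le> 2 * t * inner (A x) (A x) + t\<^sup>2 * inner (A (A x)) (A x)"
    proof -
      have "inner (A (x + t *\<^sub>R A x)) (x + t *\<^sub>R A x)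
          = inner (A x) x + t * inner (A x) (A x) + t * inner (A (A x)) x
            + t\<^sup>2 * inner (A (A x)) (A x)"
        by (simp add: L.add L.scaleR inner_add_left inner_add_right power2_eq_square algebra_simps)
      then show ?thesis
        using pos[of "x + t *\<^sub>R A x"] by (simp add: 0 sa[of "A x" x])
    qed
  qed
  then show ?thesis by simp
qed

text \<open>\<open>D = B - C\<close> anticommutes with \<open>S = B + C\<close>, so under \<open>V = I - D\<^sup>2 / k\<^sup>2\<close>, a contraction,
  the form of \<open>S\<close> at \<open>x\<close> grows by at least \<open>2 / k\<^sup>2 * inner (S (D x)) (D x)\<close> per step; as it stays
  bounded, that increment is \<open>0\<close>.\<close>

lemma positive_sqrt_unique:
  fixes B C :: "'a::real_inner \<Rightarrow> 'a"
  assumes B: "bounded_linear B" "\<And>x y. inner (B x) y = inner x (B y)" "\<And>x. 0 \<le> inner (B x) x"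
    and C: "bounded_linear C" "\<And>x y. inner (C x) y = inner x (C y)" "\<And>x. 0 \<le> inner (C x) x"
    and eq: "\<And>x. B (B x) = C (C x)"
  shows "B = C"
proof
  fix x
  define S where "S x = B x + C x" for x
  define D where "D x = B x - C x" for x
  define s where "s x = inner (S x) x" for x
  have S: "bounded_linear S" unfolding S_def by (intro bounded_linear_add B C)
  have D: "bounded_linear D" unfolding D_def by (intro bounded_linear_sub B C)
  interpret B: bounded_linear B by (rule B)
  interpret C: bounded_linear C by (rule C)
  interpret S: bounded_linear S by (rule S)
  interpret D: bounded_linear D by (rule D)
  have Ssa: "inner (S x) y = inner x (S y)" and Dsa: "inner (D x) y = inner x (D y)" for x y
    by (simp_all add: S_def D_def inner_simps B(2) C(2))
  have DS: "D (S x) = - S (D x)" for x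
    by (simp add: S_def D_def B.add B.diff C.add C.diff eq)
  have s_ge0: "0 \<le> s x" for x by (simp add: s_def S_def inner_simps B(3) C(3))
  obtain k where k: "k > 0" "\<And>x. norm (D x) \<le> norm x * k" using D.pos_bounded by blast
  obtain l where l: "l > 0" "\<And>x. norm (S x) \<le> norm x * l" using S.pos_bounded by blast
  define V where "V x = x - (1 / k\<^sup>2) *\<^sub>R D (D x)" for x
  have sDD: "inner (S x) (D (D x)) = - s (D x)" for x
    using Dsa[of "S x" "D x"] by (simp add: DS s_def)
  have s_V: "s x + 2 / k\<^sup>2 * s (D x) \<le> s (V x)" for x
  proof -
    have "s (V x) = s x + 2 / k\<^sup>2 * s (D x) + (1 / k\<^sup>2)\<^sup>2 * s (D (D x))"
      using sDD[of x] Ssa[of "D (D x)" x]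
      by (simp add: s_def V_def S.diff S.scaleR inner_simps power2_eq_square inner_commute
          algebra_simps)
    then show ?thesis using s_ge0[of "D (D x)"] by simp
  qed
  have norm_V: "norm (V x) \<le> norm x" for x
  proof -
    have "(norm (V x))\<^sup>2 = (norm x)\<^sup>2 - 2 / k\<^sup>2 * (norm (D x))\<^sup>2 + (norm (D (D x)))\<^sup>2 / k^4"
      using Dsa[of x "D x"]
      unfolding V_def power2_norm_eq_inner
      by (simp add: inner_simps inner_commute power2_eq_square power4_eq_xxxx algebra_simps)
    moreover have "(norm (D (D x)))\<^sup>2 \<le> (norm (D x) * k)\<^sup>2"
      using k by (intro power_mono) auto
    then have "(norm (D (D x)))\<^sup>2 / k^4 \<le> 1 / k\<^sup>2 * (norm (D x))\<^sup>2"
      using k(1) by (simp add: field_simps power2_eq_square power4_eq_xxxx)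
    moreover have "0 \<le> 1 / k\<^sup>2 * (norm (D x))\<^sup>2" by simp
    moreover have "2 / k\<^sup>2 * (norm (D x))\<^sup>2 = 2 * (1 / k\<^sup>2 * (norm (D x))\<^sup>2)" by simp
    ultimately have "(norm (V x))\<^sup>2 \<le> (norm x)\<^sup>2" by linarith
    then show ?thesis by (rule power2_le_imp_le) simp
  qed
  have DV: "D (V x) = V (D x)" for x by (simp add: V_def D.diff D.scaleR)
  \<comment> \<open>The increment does not decrease along the orbit, because \<open>V\<close>
    commutes with \<open>D\<close>; so \<open>n\<close> steps gain at least \<open>n\<close> times
    the first increment.\<close>
  have s_iter: "s x + real n * (2 / k\<^sup>2 * s (D x)) \<le> s ((V ^^ n) x)" for n x
  proof (induction n arbitrary: x)
    case (Suc n)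
    have "0 \<le> 2 / k\<^sup>2 * s (D (D x))" by (simp add: s_ge0)
    then have "s (D x) \<le> s (D (V x))" using s_V[of "D x"] by (simp add: DV)
    then have "real n * (2 / k\<^sup>2 * s (D x)) \<le> real n * (2 / k\<^sup>2 * s (D (V x)))"
      by (intro mult_left_mono) auto
    moreover have "real (Suc n) * a = a + real n * a" for a by (simp add: algebra_simps)
    moreover have "(V ^^ Suc n) x = (V ^^ n) (V x)" by (simp add: funpow_swap1)
    ultimately show ?case
      using Suc.IH[of "V x"] s_V[of x] by (smt (verit))
  qed simp
  have norm_iter: "norm ((V ^^ n) x) \<le> norm x" for n x
    by (induction n) (auto intro: order_trans[OF norm_V])
  have s_le: "s y \<le> l * (norm y)\<^sup>2" for y
  proof -
    have "s y \<le> norm (S y) * norm y" unfolding s_def by (rule norm_cauchy_schwarz)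
    also have "\<dots> \<le> norm y * l * norm y" using l by (intro mult_right_mono) auto
    finally show ?thesis by (simp add: power2_eq_square algebra_simps)
  qed
  have bound: "real n * (2 / k\<^sup>2 * s (D x)) \<le> l * (norm x)\<^sup>2" for n
  proof -
    have "l * (norm ((V ^^ n) x))\<^sup>2 \<le> l * (norm x)\<^sup>2"
      using l norm_iter by (intro mult_left_mono power_mono) auto
    then show ?thesis
      using s_iter[of x n] s_le[of "(V ^^ n) x"] s_ge0[of x] by linarith
  qed
  have "s (D x) = 0"
  proof (rule ccontr)
    assume "s (D x) \<noteq> 0"
    then have "2 / k\<^sup>2 * s (D x) > 0" using s_ge0[of "D x"] k by simp
    then obtain n where "l * (norm x)\<^sup>2 < real n * (2 / k\<^sup>2 * s (D x))"
      using reals_Archimedean3 by blast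
    with bound[of n] show False by simp
  qed
  then have "inner (B (D x)) (D x) = 0" "inner (C (D x)) (D x) = 0"
    using B(3)[of "D x"] C(3)[of "D x"] by (simp_all add: s_def S_def inner_simps)
  then have "B (D x) = 0" "C (D x) = 0"
    using positive_form_eq_0 B C by (blast intro: bounded_linear.linear)+
  then have "D (D x) = 0" by (simp add: D_def[of "D x"])
  then have "inner (D x) (D x) = 0" using Dsa[of x "D x"] by simp
  then show "B x = C x" by (simp add: D_def)
qed

text \<open>\<open>S = T\<^sup>1\<^sup>/\<^sup>2\<close> is obtained as \<open>I - Y\<close> with \<open>Y\<close> the fixed point of \<open>Y \<mapsto> (I - T + Y\<^sup>2) / 2\<close>, a
  contraction of the ball of radius \<open>r\<close>; it preserves the closed set of self-adjoint operators that
  commute with every operator commuting with \<open>T\<close>.\<close>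

lemma inverse_sqrt_exists:
  fixes T :: "'a::{real_inner,banach} \<Rightarrow> 'a"
  assumes T: "bounded_linear T" "\<And>x y. inner (T x) y = inner x (T y)"
    and r: "0 \<le> r" "r < 1" "\<And>x. norm (x - T x) \<le> r * norm x"
  obtains L where "bounded_linear L" "\<And>x y. inner (L x) y = inner x (L y)"
    "\<And>x. 0 \<le> inner (L x) x" "\<And>x. L (L (T x)) = x"
    "\<And>g x. \<lbrakk>bounded_linear g; \<And>x. g (T x) = T (g x)\<rbrakk> \<Longrightarrow> g (L x) = L (g x)"
proof -
  interpret T: bounded_linear T by (rule T)
  define B where "B = Blinfun (\<lambda>x. x - T x)"
  have B: "blinfun_apply B x = x - T x" for x
    unfolding B_def
    by (subst bounded_linear_Blinfun_apply) (intro bounded_linear_sub bounded_linear_ident T | simp)+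
  have norm_B: "norm B \<le> r" using r by (intro norm_blinfun_bound) (auto simp: B)
  define comm where "comm = {g. bounded_linear g \<and> (\<forall>x. g (T x) = T (g x))}"
  define \<Y> where "\<Y> = cball 0 r \<inter> {Y. \<forall>x y. inner (blinfun_apply Y x) y = inner x (blinfun_apply Y y)}
      \<inter> (\<Inter>g\<in>comm. {Y. \<forall>x. g (blinfun_apply Y x) = blinfun_apply Y (g x)})"
  have "closed {Y. \<forall>x. g (blinfun_apply Y x) = blinfun_apply Y (g x)}" if "g \<in> comm" for g
  proof -
    interpret g: bounded_linear g using that by (simp add: comm_def)
    show ?thesis by (intro closed_Collect_all closed_Collect_eq continuous_intros g.continuous_on)
  qed
  then have "closed \<Y>"
    unfolding \<Y>_def
    by (intro closed_Int closed_INT ballI closed_cball closed_Collect_all closed_Collect_eq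
        continuous_intros) auto
  define f where "f Y = (1/2) *\<^sub>R (B + (Y o\<^sub>L Y))" for Y
  have comm_B: "g (x - T x) = g x - T (g x)" if "g \<in> comm" for g x
    using that by (auto simp: comm_def linear_diff bounded_linear.linear)
  have f_in: "f Y \<in> \<Y>" if Y: "Y \<in> \<Y>" for Y
  proof -
    have "norm (B + (Y o\<^sub>L Y)) \<le> norm B + norm (Y o\<^sub>L Y)" by (rule norm_triangle_ineq)
    also have "\<dots> \<le> r + r * r"
    proof -
      have "norm (Y o\<^sub>L Y) \<le> norm Y * norm Y" by (rule norm_blinfun_compose)
      also have "\<dots> \<le> r * r" using Y r by (intro mult_mono) (auto simp: \<Y>_def)
      finally show ?thesis using norm_B by simp
    qed
    also have "\<dots> \<le> 2 * r" using r mult_left_mono[of r 1 r] by simp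
    finally have "norm (f Y) \<le> r" by (simp add: f_def)
    moreover have "inner (blinfun_apply (f Y) x) y = inner x (blinfun_apply (f Y) y)" for x y
      using Y by (simp add: f_def \<Y>_def blinfun.bilinear_simps B inner_simps T(2))
    moreover have "g (blinfun_apply (f Y) x) = blinfun_apply (f Y) (g x)" if g: "g \<in> comm" for g x
    proof -
      interpret g: bounded_linear g using g by (simp add: comm_def)
      have "g (blinfun_apply Y (blinfun_apply Y x)) = blinfun_apply Y (blinfun_apply Y (g x))"
        using Y g by (simp add: \<Y>_def)
      then show ?thesis
        by (simp add: f_def blinfun.bilinear_simps B g.scaleR g.add comm_B[OF g])
    qed
    ultimately show ?thesis by (simp add: \<Y>_def)
  qed
  have lip: "dist (f Y) (f Z) \<le> r * dist Y Z" if "Y \<in> \<Y>" "Z \<in> \<Y>" for Y Z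
  proof -
    \<comment> \<open>The factors need not commute, so \<open>Y^2 - Z^2\<close> is split as
      \<open>Y (Y - Z) + (Y - Z) Z\<close>.\<close>
    have "f Y - f Z = (1/2) *\<^sub>R ((Y o\<^sub>L (Y - Z)) + ((Y - Z) o\<^sub>L Z))"
      by (intro blinfun_eqI) (simp add: f_def blinfun.bilinear_simps algebra_simps)
    then have "norm (f Y - f Z) \<le> (norm (Y o\<^sub>L (Y - Z)) + norm ((Y - Z) o\<^sub>L Z)) / 2"
      using norm_triangle_ineq[of "Y o\<^sub>L (Y - Z)" "(Y - Z) o\<^sub>L Z"] by simp
    also have "\<dots> \<le> (r * norm (Y - Z) + r * norm (Y - Z)) / 2"
    proof -
      have "norm Y * norm (Y - Z) \<le> r * norm (Y - Z)" "norm Z * norm (Y - Z) \<le> r * norm (Y - Z)"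
        using that by (auto intro!: mult_right_mono simp: \<Y>_def)
      then show ?thesis
        using norm_blinfun_compose[of Y "Y - Z"] norm_blinfun_compose[of "Y - Z" Z]
          by (simp add: mult.commute)
    qed
    finally show ?thesis by (simp add: dist_norm)
  qed
  have "0 \<in> \<Y>"
    using r by (auto simp: \<Y>_def comm_def linear_0 bounded_linear.linear)
  then have "\<exists>!Y\<in>\<Y>. f Y = Y"
    using \<open>closed \<Y>\<close> f_in lip r by (intro Banach_fix) (auto simp: complete_eq_closed)
  then obtain Y where Y: "Y \<in> \<Y>" "f Y = Y" by blast
  define S where "S x = x - blinfun_apply Y x" for x
  have "2 *\<^sub>R blinfun_apply Y x = x - T x + blinfun_apply Y (blinfun_apply Y x)" for x
    using arg_cong[OF Y(2), of "\<lambda>Y. 2 *\<^sub>R blinfun_apply Y x"]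
    by (simp add: f_def blinfun.bilinear_simps B)
  \<comment> \<open>The fixed-point equation \<open>2 Y = I - T + Y^2\<close> rearranges to
    \<open>(I - Y)^2 = T\<close>.\<close>
  then have SS: "S (S x) = T x" for x
    by (simp add: S_def blinfun.diff_right scaleR_2 algebra_simps)
  have norm_Y: "norm (blinfun_apply Y x) \<le> r * norm x" for x
  proof -
    have "norm (blinfun_apply Y x) \<le> norm Y * norm x" by (rule norm_blinfun)
    also have "\<dots> \<le> r * norm x" using Y(1) by (intro mult_right_mono) (auto simp: \<Y>_def)
    finally show ?thesis .
  qed
  have Ssa: "inner (S x) y = inner x (S y)" for x y
    using Y(1) by (simp add: S_def \<Y>_def inner_simps)
  have S_comm: "g (S x) = S (g x)" if "g \<in> comm" for g x
    using Y(1) that by (auto simp: S_def \<Y>_def comm_def linear_diff bounded_linear.linear)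
  have S_below: "(1 - r) * norm x \<le> norm (S x)" for x
    using norm_Y[of x] norm_triangle_ineq2[of x "blinfun_apply Y x"]
    by (simp add: S_def algebra_simps)
  have S_pos: "0 \<le> inner (S x) x" for x
  proof -
    have "inner (blinfun_apply Y x) x \<le> norm (blinfun_apply Y x) * norm x"
      by (rule norm_cauchy_schwarz)
    also have "\<dots> \<le> r * norm x * norm x" using norm_Y by (intro mult_right_mono) auto
    also have "\<dots> \<le> 1 * norm x * norm x" using r by (intro mult_right_mono) auto
    finally show ?thesis
      by (simp add: S_def inner_simps dot_square_norm power2_eq_square)
  qed
  interpret S: linear S
    by unfold_locales (simp_all add: S_def blinfun.bilinear_simps algebra_simps)
  have "inj S"
  proof (rule injI)
    fix x y assume "S x = S y"
    then have "(1 - r) * norm (x - y) \<le> 0" using S_below[of "x - y"] by (simp add: S.diff)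
    then show "x = y" using r by (simp add: mult_le_0_iff)
  qed
  moreover have "surj S"
  proof -
    \<comment> \<open>Solving \<open>x - Y x = y\<close> amounts to finding a fixed point of the
      contraction \<open>x \<mapsto> y + Y x\<close>.\<close>
    have "\<exists>x. S x = y" for y
    proof -
      have "dist (y + blinfun_apply Y u) (y + blinfun_apply Y v) \<le> r * dist u v" for u v
        using norm_Y[of "u - v"] by (simp add: dist_norm blinfun.diff_right)
      then have "\<exists>!x. y + blinfun_apply Y x = x" using r by (intro banach_fix_type) auto
      then obtain x where "y + blinfun_apply Y x = x" by blast
      then have "S x = y" by (simp add: S_def diff_eq_eq)
      then show ?thesis ..
    qed
    then show ?thesis by (metis surjI)
  qed
  ultimately have bij: "bij S" by (simp add: bij_def)
  define L where "L = inv S"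
  have SL: "S (L x) = x" and LS: "L (S x) = x" for x
    using bij by (simp_all add: L_def bij_is_surj surj_f_inv_f bij_is_inj)
  show ?thesis
  proof (rule that)
    show "bounded_linear L"
    proof (rule bounded_linear_intro)
      show "L (x + y) = L x + L y" for x y using LS[of "L x + L y"] by (simp add: S.add SL)
      show "L (c *\<^sub>R x) = c *\<^sub>R L x" for c x using LS[of "c *\<^sub>R L x"] by (simp add: S.scaleR SL)
      show "norm (L x) \<le> norm x * (1 / (1 - r))" for x
        using S_below[of "L x"] r by (simp add: SL field_simps)
    qed
    show "inner (L x) y = inner x (L y)" for x y using Ssa[of "L x" "L y"] by (simp add: SL)
    show "0 \<le> inner (L x) x" for x using S_pos[of "L x"] by (simp add: SL inner_commute)
    show "L (L (T x)) = x" for x by (simp add: SS[symmetric] LS)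
    show "g (L x) = L (g x)" if "bounded_linear g" "\<And>x. g (T x) = T (g x)" for g x
      using LS[of "g (L x)"] S_comm[of g "L x"] that by (simp add: comm_def SL)
  qed
qed

section \<open>Complex Hilbert spaces\<close>

lemma inner_scaleC: "inner (c *\<^sub>C x) y = inner x (cnj c *\<^sub>C (y::'a::complex_inner))"
proof -
  have "cinner x (cnj c *\<^sub>C y) = c * cinner x y"
    by (metis cinner_commute cinner_scaleC_left complex_cnj_cnj complex_cnj_mult)
  then show ?thesis by (metis Re_cinner cinner_scaleC_left)
qed

lemma Im_cinner: "Im (cinner x y) = inner x (\<i> *\<^sub>C (y::'a::complex_inner))"
proof -
  have "cinner x (\<i> *\<^sub>C y) = - \<i> * cinner x y"
    by (metis cinner_commute cinner_scaleC_left complex_cnj_i complex_cnj_mult)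
  then have "Re (cinner x (\<i> *\<^sub>C y)) = Im (cinner x y)" by simp
  then show ?thesis by (simp only: Re_cinner)
qed

lemma cinner_eq_Complex: "cinner x y = Complex (inner x y) (inner x (\<i> *\<^sub>C (y::'a::complex_inner)))"
  by (rule complex_eqI) (simp_all only: Re_cinner Im_cinner complex.sel)

lemma norm_scaleC: "norm (c *\<^sub>C x) = cmod c * norm (x::'a::complex_inner)"
proof -
  have "inner (c *\<^sub>C x) (c *\<^sub>C x) = (cmod c)\<^sup>2 * inner x x"
  proof -
    have "cnj c *\<^sub>C c *\<^sub>C x = (cmod c)\<^sup>2 *\<^sub>R x"
      by (simp only: scaleC_scaleC scaleR_scaleC complex_norm_square mult.commute)
    then show ?thesis by (simp only: inner_scaleC inner_scaleR_right)
  qed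
  then show ?thesis by (simp add: norm_eq_sqrt_inner real_sqrt_mult)
qed

lemma bounded_linear_scaleC: "bounded_linear (\<lambda>x::'a::complex_inner. c *\<^sub>C x)"
proof (rule bounded_linear_intro)
  show "c *\<^sub>C (r *\<^sub>R x) = r *\<^sub>R (c *\<^sub>C x)" for r and x :: 'a
    by (simp add: scaleR_scaleC scaleC_scaleC mult.commute)
  show "norm (c *\<^sub>C x) \<le> norm x * cmod c" for x :: 'a
    by (simp add: norm_scaleC mult.commute)
qed (rule scaleC_add_right)

lemma scaleC_minus_left: "(- c) *\<^sub>C x = - (c *\<^sub>C (x::'a::complex_inner))"
  using scaleR_scaleC[of "-1" "c *\<^sub>C x"] by (simp add: scaleC_scaleC)

lemma scaleC_diff_right: "c *\<^sub>C (x - y) = c *\<^sub>C x - c *\<^sub>C (y::'a::complex_inner)"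
  by (rule bounded_linear.linear[OF bounded_linear_scaleC, THEN linear_diff])

lemma scaleC_minus_right: "c *\<^sub>C (- x) = - (c *\<^sub>C (x::'a::complex_inner))"
  by (rule bounded_linear.linear[OF bounded_linear_scaleC, THEN linear_neg])

lemma scaleC_scaleR: "c *\<^sub>C (r *\<^sub>R x) = r *\<^sub>R (c *\<^sub>C (x::'a::complex_inner))"
  by (rule bounded_linear.linear[OF bounded_linear_scaleC, THEN linear_scale])

lemma bounded_clinearD:
  assumes "bounded_clinear A"
  shows "bounded_linear A" "linear A" "A (c *\<^sub>C x) = c *\<^sub>C A x" "A 0 = 0"
    "A (x + y) = A x + A y" "A (x - y) = A x - A y" "A (- x) = - A x" "A (r *\<^sub>R x) = r *\<^sub>R A x"
  using assms
  by (auto simp: bounded_clinear_def bounded_linear.linear linear_0 linear_add linear_diff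
      linear_neg linear_scale)

lemma bounded_clinear_ident: "bounded_clinear (\<lambda>x. x)"
  by (simp add: bounded_clinear_def)

lemma bounded_clinear_add:
  "bounded_clinear A \<Longrightarrow> bounded_clinear B \<Longrightarrow> bounded_clinear (\<lambda>x. A x + B x)"
  by (simp add: bounded_clinear_def bounded_linear_add scaleC_add_right)

lemma bounded_clinear_diff:
  "bounded_clinear A \<Longrightarrow> bounded_clinear B \<Longrightarrow> bounded_clinear (\<lambda>x. A x - B x)"
  by (simp add: bounded_clinear_def bounded_linear_sub scaleC_diff_right)

lemma bounded_clinear_minus: "bounded_clinear A \<Longrightarrow> bounded_clinear (\<lambda>x. - A x)"
  by (simp add: bounded_clinear_def bounded_linear_minus scaleC_minus_right)

lemma bounded_clinear_scaleR: "bounded_clinear A \<Longrightarrow> bounded_clinear (\<lambda>x. r *\<^sub>R A x)"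
  by (simp add: bounded_clinear_def bounded_linear_const_scaleR scaleC_scaleR)

lemma bounded_clinear_compose:
  "bounded_clinear A \<Longrightarrow> bounded_clinear B \<Longrightarrow> bounded_clinear (\<lambda>x. A (B x))"
  by (simp add: bounded_clinear_def bounded_linear_compose)

lemmas bounded_clinear_intros = bounded_clinear_ident bounded_clinear_add bounded_clinear_diff
  bounded_clinear_minus bounded_clinear_scaleR

text \<open>Working with the real inner product suffices: for complex-linear maps the imaginary part of
  an adjointness relation is the real part with \<open>y\<close> replaced by \<open>\<i> *\<^sub>C y\<close>.\<close>

lemma cinner_adjointI:
  assumes "bounded_clinear B" "\<And>x y. inner (A x) y = inner x (B y)"
  shows "cinner (A x) y = cinner x (B y)"
  by (simp add: cinner_eq_Complex assms(2) bounded_clinearD[OF assms(1)])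

section \<open>Adjoints and self-adjoint operators\<close>

lemma adj_eqI:
  assumes B: "bounded_clinear B" "\<And>x y. inner (A x) y = inner x (B y)"
  shows "adj A = B"
  unfolding adj_def
proof (rule the_equality)
  show "bounded_clinear B \<and> (\<forall>x y. cinner (A x) y = cinner x (B y))"
    using B cinner_adjointI by blast
  show "C = B" if C: "bounded_clinear C \<and> (\<forall>x y. cinner (A x) y = cinner x (C y))" for C
  proof
    fix y
    have "inner x (C y) = inner x (B y)" for x
      using C B(2)[of x y] by (metis Re_cinner)
    then show "C y = B y" by (metis vector_eq_ldot)
  qed
qed

text \<open>Riesz representation of \<open>x \<mapsto> inner (A x) y\<close> supplies
  \<open>B y\<close>; linearity follows by testing against all vectors.\<close>

lemma adjoint_exists:
  assumes A: "bounded_clinear A"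
  obtains B where "bounded_clinear B" "\<And>x y. inner (A x) y = inner x (B y)"
proof -
  note A' = bounded_clinearD[OF A]
  have "\<exists>b. \<forall>x. inner (A x) y = inner x b" for y
  proof -
    have "bounded_linear (\<lambda>x. inner (A x) y)" by (rule bounded_linear_inner_left_comp[OF A'(1)])
    then have "\<exists>b\<in>UNIV. \<forall>x\<in>UNIV. inner (A x) y = inner b x"
      by (intro riesz_on_closed_subspace subspace_UNIV closed_UNIV)
    then show ?thesis by (auto simp: inner_commute)
  qed
  then obtain B where B: "\<And>x y. inner (A x) y = inner x (B y)" by metis
  obtain k where k: "\<And>x. norm (A x) \<le> norm x * k" using bounded_linear.bounded[OF A'(1)] by auto
  have "bounded_linear B"
  proof (rule bounded_linear_intro)
    show "B (x + y) = B x + B y" for x y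
      by (rule vector_eq_ldot[THEN iffD1]) (metis B inner_add_right)
    show "B (r *\<^sub>R x) = r *\<^sub>R B x" for r x
      by (rule vector_eq_ldot[THEN iffD1]) (metis B inner_scaleR_right)
    show "norm (B x) \<le> norm x * k" for x
    proof (cases "B x = 0")
      case True
      have "norm (A x) \<le> norm x * k" by (rule k)
      then show ?thesis using True norm_ge_zero[of "A x"] by (simp del: norm_ge_zero)
    next
      case False
      have "norm (B x) * norm (B x) = inner (A (B x)) x" by (simp add: B flip: power2_eq_square power2_norm_eq_inner)
      also have "\<dots> \<le> norm (A (B x)) * norm x" by (rule norm_cauchy_schwarz)
      also have "\<dots> \<le> norm (B x) * k * norm x" using k by (intro mult_right_mono) auto
      finally show ?thesis using False by (simp add: mult.assoc mult.commute)
    qed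
  qed
  moreover have "B (c *\<^sub>C y) = c *\<^sub>C B y" for c y
  proof (rule vector_eq_ldot[THEN iffD1], rule allI)
    fix x
    have "inner x (B (c *\<^sub>C y)) = inner (cnj c *\<^sub>C A x) y" by (simp add: B[symmetric] inner_scaleC)
    also have "\<dots> = inner x (c *\<^sub>C B y)" by (simp flip: A'(3)) (simp add: B inner_scaleC)
    finally show "inner x (B (c *\<^sub>C y)) = inner x (c *\<^sub>C B y)" .
  qed
  ultimately show ?thesis using that B by (auto simp: bounded_clinear_def)
qed

lemma adj_works:
  assumes "bounded_clinear A"
  shows "bounded_clinear (adj A)" "inner (A x) y = inner x (adj A y)"
    "inner (adj A x) y = inner x (A y)"
  using adjoint_exists[OF assms] adj_eqI by (metis inner_commute)+

text \<open>Self-adjointness through the real inner product, free of the definite description in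
  \<open>adj\<close>.\<close>

definition hermitian :: "('a::chilbert_space \<Rightarrow> 'a) \<Rightarrow> bool"
  where "hermitian A \<longleftrightarrow> bounded_clinear A \<and> (\<forall>x y. inner (A x) y = inner x (A y))"

lemma hermitianI:
  "bounded_clinear A \<Longrightarrow> (\<And>x y. inner (A x) y = inner x (A y)) \<Longrightarrow> hermitian A"
  by (simp add: hermitian_def)

lemma hermitianD:
  assumes "hermitian A"
  shows "bounded_clinear A" "inner (A x) y = inner x (A y)"
  using assms by (simp_all add: hermitian_def)

lemma hermitian_adj: "hermitian A \<Longrightarrow> adj A = A"
  by (rule adj_eqI) (auto dest: hermitianD)

lemma symmetry_iff: "symmetry J \<longleftrightarrow> hermitian J \<and> (\<forall>x. J (J x) = x)"
proof
  assume J: "symmetry J"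
  then have "J (J x) = x" for x
    by (metis bij_inv_eq_iff symmetry_def)
  moreover have "hermitian J"
    using J adj_works(2)[of J] by (metis hermitianI symmetry_def)
  ultimately show "hermitian J \<and> (\<forall>x. J (J x) = x)" by simp
next
  assume J: "hermitian J \<and> (\<forall>x. J (J x) = x)"
  then have "bij J" by (metis bijI' )
  moreover have "J = inv J" using J by (metis inv_unique_comp comp_apply eq_id_iff)
  ultimately show "symmetry J"
    using J by (simp add: symmetry_def hermitian_adj hermitianD)
qed

text \<open>Moving \<open>\<i>\<close> across a self-adjoint operator flips its sign, so the form
  has no imaginary part.\<close>

lemma loewner_le_hermitian_iff:
  assumes "hermitian A" "hermitian B"
  shows "A \<le>\<^sub>L B \<longleftrightarrow> (\<forall>x. inner (A x) x \<le> inner (B x) x)"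
proof -
  have im: "inner (C x) (\<i> *\<^sub>C x) = 0" if "hermitian C" for C :: "'a \<Rightarrow> 'a" and x
  proof -
    have "inner (C x) (\<i> *\<^sub>C x) = inner (cnj \<i> *\<^sub>C C x) x" by (simp only: inner_scaleC complex_cnj_cnj)
    also have "\<dots> = inner (C (cnj \<i> *\<^sub>C x)) x" using that by (metis hermitianD(1) bounded_clinearD(3))
    also have "\<dots> = inner (cnj \<i> *\<^sub>C x) (C x)" using that by (rule hermitianD(2))
    also have "\<dots> = - inner (C x) (\<i> *\<^sub>C x)"
      by (simp add: scaleC_minus_left inner_commute)
    finally show ?thesis by simp
  qed
  show ?thesis
    unfolding loewner_le_def
    by (simp add: complex_nonneg_Reals_iff Re_cinner Im_cinner inner_diff_left im assms)
qed

text \<open>Polarisation: the imaginary part of the form vanishes at \<open>x\<close>, at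
  \<open>\<i> *\<^sub>C y\<close> and at their sum. This serves \<open>op_abs\<close>, whose
  description asks for positivity only.\<close>

lemma hermitian_if_loewner_nonneg:
  fixes x :: "'a::chilbert_space"
  assumes B: "bounded_clinear B" and pos: "(\<lambda>x. 0) \<le>\<^sub>L B"
  shows "hermitian B" "0 \<le> inner (B x) x"
proof -
  have form: "0 \<le> inner (B x) x" "inner (B x) (\<i> *\<^sub>C x) = 0" for x
    using pos by (auto simp: loewner_le_def complex_nonneg_Reals_iff Re_cinner Im_cinner)
  show "0 \<le> inner (B x) x" by (rule form)
  show "hermitian B"
  proof (rule hermitianI[OF B])
    fix x y :: 'a
    have ii: "\<i> *\<^sub>C \<i> *\<^sub>C y = - y"
      using scaleR_scaleC[of "-1" y] by (simp add: scaleC_scaleC)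
    have "inner (B (x + \<i> *\<^sub>C y)) (\<i> *\<^sub>C (x + \<i> *\<^sub>C y)) = 0" by (rule form)
    then have "inner (B x) (\<i> *\<^sub>C \<i> *\<^sub>C y) + inner (B (\<i> *\<^sub>C y)) (\<i> *\<^sub>C x) = 0"
      using form(2)[of x] form(2)[of "\<i> *\<^sub>C y"]
      by (simp add: bounded_clinearD(5)[OF B] scaleC_add_right inner_simps)
    moreover have "inner (B (\<i> *\<^sub>C y)) (\<i> *\<^sub>C x) = inner (B y) x"
    proof -
      have "inner (\<i> *\<^sub>C B y) (\<i> *\<^sub>C x) = inner (B y) (cnj \<i> *\<^sub>C \<i> *\<^sub>C x)" by (rule inner_scaleC)
      then show ?thesis by (simp add: bounded_clinearD(3)[OF B] scaleC_scaleC scaleC_one)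
    qed
    ultimately show "inner (B x) y = inner x (B y)" by (simp add: ii inner_commute)
  qed
qed

lemma positive_hermitian_sqrt_unique:
  assumes "hermitian B" "\<And>x. 0 \<le> inner (B x) x" "hermitian C" "\<And>x. 0 \<le> inner (C x) x"
    and "\<And>x. B (B x) = C (C x)"
  shows "B = C"
  using assms by (intro positive_sqrt_unique) (auto dest: hermitianD bounded_clinearD)

lemma op_abs_eqI:
  assumes C: "hermitian C" "\<And>x. 0 \<le> inner (C x) x" and A: "hermitian A"
    and sq: "\<And>x. C (C x) = A (A x)"
  shows "op_abs A = C"
  unfolding op_abs_def
proof (rule the_equality)
  have zero: "hermitian (\<lambda>x::'a. 0)"
    using bounded_clinear_scaleR[OF bounded_clinear_ident, of 0] by (auto intro: hermitianI)
  show "bounded_clinear C \<and> (\<lambda>x. 0) \<le>\<^sub>L C \<and> C \<circ> C = adj A \<circ> A"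
    using C A sq by (auto simp: hermitian_adj loewner_le_hermitian_iff zero dest: hermitianD)
  show "B = C" if B: "bounded_clinear B \<and> (\<lambda>x. 0) \<le>\<^sub>L B \<and> B \<circ> B = adj A \<circ> A" for B
  proof (rule positive_hermitian_sqrt_unique)
    show "B (B x) = C (C x)" for x
      using B sq A by (metis comp_apply hermitian_adj)
  qed (use B C hermitian_if_loewner_nonneg in blast)+
qed

section \<open>Orthogonal projections\<close>

definition csubspace :: "'a::complex_inner set \<Rightarrow> bool"
  where "csubspace M \<longleftrightarrow> subspace M \<and> (\<forall>c. \<forall>x\<in>M. c *\<^sub>C x \<in> M)"

lemma subspace_closure:
  fixes M :: "'a::real_normed_vector set"
  assumes "subspace M"
  shows "subspace (closure M)"
  unfolding subspace_def Ball_def closure_sequential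
proof (intro conjI allI impI; (elim exE conjE)?)
  show "\<exists>f. (\<forall>n. f n \<in> M) \<and> f \<longlonglongrightarrow> 0"
    using assms by (intro exI[of _ "\<lambda>_. 0"]) (simp add: subspace_0)
  show "\<exists>h. (\<forall>n. h n \<in> M) \<and> h \<longlonglongrightarrow> x + y"
    if "\<forall>n. f n \<in> M" "f \<longlonglongrightarrow> x" "\<forall>n. g n \<in> M" "g \<longlonglongrightarrow> y" for x y f g
    using that assms by (intro exI[of _ "\<lambda>n. f n + g n"]) (simp add: subspace_add tendsto_add)
  show "\<exists>h. (\<forall>n. h n \<in> M) \<and> h \<longlonglongrightarrow> c *\<^sub>R x"
    if "\<forall>n. f n \<in> M" "f \<longlonglongrightarrow> x" for c x f
    using that assms by (intro exI[of _ "\<lambda>n. c *\<^sub>R f n"]) (simp add: subspace_scale tendsto_scaleR)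
qed

lemma csubspace_closure_range: "bounded_clinear A \<Longrightarrow> csubspace (closure (range A))"
proof -
  assume A: "bounded_clinear A"
  have "(\<lambda>x. c *\<^sub>C x) ` closure (range A) \<subseteq> closure (range A)" for c
    by (rule image_closure_subset)
      (auto intro!: linear_continuous_on bounded_linear_scaleC closure_subset[THEN subsetD]
        simp flip: bounded_clinearD(3)[OF A])
  moreover have "subspace (closure (range A))"
    using bounded_clinearD(2)[OF A] by (intro subspace_closure linear_subspace_image subspace_UNIV)
  ultimately show ?thesis by (auto simp: csubspace_def)
qed

lemma csubspace_null_space: "bounded_clinear A \<Longrightarrow> csubspace (null_space A)"
  by (auto simp: csubspace_def null_space_def subspace_def bounded_clinearD scaleC_scaleR)
    (metis scaleC_scaleR scaleR_zero_left)

lemma closed_null_space: "bounded_clinear A \<Longrightarrow> closed (null_space A)"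
  unfolding null_space_def
  by (intro closed_Collect_eq linear_continuous_on bounded_clinearD continuous_on_const)

text \<open>Real orthogonality to \<open>M\<close> suffices because \<open>M\<close> is stable under
  multiplication by \<open>\<i>\<close>.\<close>

lemma orth_proj_eqI:
  assumes M: "csubspace M" and y: "y \<in> M" "\<And>z. z \<in> M \<Longrightarrow> inner (x - y) z = 0"
  shows "orth_proj M x = y"
  unfolding orth_proj_def
proof (rule the_equality)
  show "y \<in> M \<and> (\<forall>z\<in>M. cinner (x - y) z = 0)"
    using M y by (auto simp: cinner_eq_Complex csubspace_def complex_eq_iff)
  show "w = y" if w: "w \<in> M \<and> (\<forall>z\<in>M. cinner (x - w) z = 0)" for w
  proof -
    have "w - y \<in> M" using M w y by (auto simp: csubspace_def intro: subspace_diff)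
    then have "inner (x - w) (w - y) = 0" "inner (x - y) (w - y) = 0"
      using w y(2) by (metis Re_cinner zero_complex.simps(1))+
    then have "inner (w - y) (w - y) = 0" by (simp add: inner_diff_left)
    then show ?thesis by simp
  qed
qed

lemma orth_proj_works:
  assumes M: "csubspace M" "closed M"
  shows "orth_proj M x \<in> M" "z \<in> M \<Longrightarrow> inner (x - orth_proj M x) z = 0"
proof -
  obtain y where y: "y \<in> M" "\<And>z. z \<in> M \<Longrightarrow> inner x z = inner y z"
    using riesz_on_closed_subspace[OF _ M(2) bounded_linear_inner_right[of x]] M(1)
    unfolding csubspace_def by blast
  then have "orth_proj M x = y" using M(1) by (intro orth_proj_eqI) (auto simp: inner_diff_left)
  with y show "orth_proj M x \<in> M" "z \<in> M \<Longrightarrow> inner (x - orth_proj M x) z = 0"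
    by (auto simp: inner_diff_left)
qed

lemma orth_proj_ident: "csubspace M \<Longrightarrow> x \<in> M \<Longrightarrow> orth_proj M x = x"
  by (rule orth_proj_eqI) auto

lemma hermitian_orth_proj:
  assumes M: "csubspace M" "closed M"
  shows "hermitian (orth_proj M)"
proof (rule hermitianI)
  note p = orth_proj_works[OF M]
  have sub: "subspace M" and scale: "\<And>c x. x \<in> M \<Longrightarrow> c *\<^sub>C x \<in> M"
    using M by (auto simp: csubspace_def)
  \<comment> \<open>The right-hand side is symmetric in \<open>x\<close> and \<open>y\<close>, which
    gives self-adjointness; \<open>y = x\<close> gives contractivity.\<close>
  have form: "inner (orth_proj M x) y = inner (orth_proj M x) (orth_proj M y)" for x y
    using p(2)[OF p(1), of y x] by (simp add: inner_diff_left inner_diff_right inner_commute[of _ "orth_proj M x"])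
  show "inner (orth_proj M x) y = inner x (orth_proj M y)" for x y
    by (metis form inner_commute)
  have add: "orth_proj M (x + y) = orth_proj M x + orth_proj M y" for x y
    using p(2)[of _ x] p(2)[of _ y] p(1) sub
    by (intro orth_proj_eqI M) (auto simp: inner_simps intro: subspace_add)
  have scaleC: "orth_proj M (c *\<^sub>C x) = c *\<^sub>C orth_proj M x" for c x
  proof (rule orth_proj_eqI[OF M(1)])
    show "inner (c *\<^sub>C x - c *\<^sub>C orth_proj M x) z = 0" if "z \<in> M" for z
      using p(2)[of "cnj c *\<^sub>C z" x] scale[OF that] by (simp add: inner_scaleC flip: scaleC_diff_right)
  qed (rule scale[OF p(1)])
  have "bounded_linear (orth_proj M)"
  proof (rule bounded_linear_intro)
    show "orth_proj M (r *\<^sub>R x) = r *\<^sub>R orth_proj M x" for r x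
      by (simp add: scaleR_scaleC scaleC)
    show "norm (orth_proj M x) \<le> norm x * 1" for x
    proof (cases "orth_proj M x = 0")
      case False
      have "norm (orth_proj M x) * norm (orth_proj M x) = inner (orth_proj M x) x"
        by (simp add: form flip: power2_eq_square power2_norm_eq_inner)
      also have "\<dots> \<le> norm (orth_proj M x) * norm x" by (rule norm_cauchy_schwarz)
      finally show ?thesis using False by simp
    qed simp
  qed (rule add)
  then show "bounded_clinear (orth_proj M)" by (simp add: bounded_clinear_def scaleC)
qed

text \<open>The residual of projecting \<open>x\<close> onto the closure is annihilated by
  \<open>A\<close>, hence orthogonal to \<open>x\<close> as well as to the projection, hence
  zero.\<close>

lemma orth_null_space_closure_range:
  assumes A: "hermitian A" and x: "\<And>z. A z = 0 \<Longrightarrow> inner x z = 0"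
  shows "x \<in> closure (range A)"
proof -
  define y where "y = orth_proj (closure (range A)) x"
  have y: "y \<in> closure (range A)" "\<And>z. z \<in> closure (range A) \<Longrightarrow> inner (x - y) z = 0"
    using orth_proj_works[OF csubspace_closure_range, of A] hermitianD(1)[OF A] by (auto simp: y_def)
  have "inner (A (x - y)) (A (x - y)) = inner (x - y) (A (A (x - y)))"
    by (rule hermitianD(2)[OF A])
  also have "\<dots> = 0" by (rule y(2)) (auto intro: closure_subset[THEN subsetD])
  finally have "A (x - y) = 0" by simp
  then have "inner x (x - y) = 0" by (rule x)
  moreover have "inner (x - y) y = 0" by (rule y(2)[OF y(1)])
  ultimately have "inner (x - y) (x - y) = 0" by (simp add: inner_diff_left inner_diff_right inner_commute)
  then show ?thesis using y(1) by simp
qed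

section \<open>Symmetries adapted to an idempotent\<close>

locale bounded_idempotent =
  fixes P :: "'a::chilbert_space \<Rightarrow> 'a"
  assumes P: "bounded_clinear P" and idem: "P (P x) = P x"
begin

abbreviation "Q \<equiv> adj P"

lemmas PQ = adj_works(2)[OF P] and QP = adj_works(3)[OF P] and Q = adj_works(1)[OF P]

lemmas PQ_intros =
  bounded_clinear_intros bounded_clinear_compose[OF P] bounded_clinear_compose[OF Q]

lemmas P_lin = bounded_clinearD[OF P] and Q_lin = bounded_clinearD[OF Q]

lemma idem_adj: "Q (Q x) = Q x"
  by (rule vector_eq_ldot[THEN iffD1]) (metis PQ idem)

text \<open>\<open>Q x = - P x\<close> makes \<open>inner (P x) x\<close> its own negative, while
  idempotency makes it minus the squared norm of \<open>P x\<close>. Thus N(P + Q) is the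
  intersection of N(P) and N(Q).\<close>

lemma sum_eq_0D:
  assumes "P x + Q x = 0"
  shows "P x = 0" "Q x = 0"
proof -
  have Qx: "Q x = - P x" using assms by (simp add: eq_neg_iff_add_eq_0 add.commute)
  have "inner (P x) x = 0" using PQ[of x x] by (simp add: Qx inner_commute)
  moreover have "inner (P x) (P x) = - inner (P x) x"
    using PQ[of "P x" x] by (simp add: Qx idem)
  ultimately show "P x = 0" by simp
  then show "Q x = 0" by (simp add: Qx)
qed

text \<open>Since \<open>J P = Q J\<close> gives \<open>Q J P = J P\<close>, the last clause is the
  inequality between \<open>Q J P\<close> and \<open>J\<close> in a form linear in
  \<open>P\<close>.\<close>

definition admissible :: "('a \<Rightarrow> 'a) \<Rightarrow> bool"
  where "admissible J \<longleftrightarrow> hermitian J \<and> (\<forall>x. J (J x) = x) \<and>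
    (\<forall>x. J (P x) = Q (J x)) \<and> (\<forall>x. 0 \<le> inner (J (x - P x)) x)"

text \<open>If \<open>P\<^sup>* J P \<le> J\<close> then the form of \<open>J - P\<^sup>* J P\<close> vanishes on the range of \<open>P\<close>; being
  positive, \<open>J - P\<^sup>* J P\<close> annihilates that range, that is \<open>J P = P\<^sup>* J P\<close>.\<close>

lemma symmetry_le_iff_admissible:
  "symmetry J \<and> Q \<circ> J \<circ> P \<le>\<^sub>L J \<longleftrightarrow> admissible J"
proof -
  have "Q \<circ> J \<circ> P \<le>\<^sub>L J \<longleftrightarrow> (\<forall>x. J (P x) = Q (J x)) \<and> (\<forall>x. 0 \<le> inner (J (x - P x)) x)"
    if J: "hermitian J"
  proof -
    note Jb = hermitianD(1)[OF J] and Jsa = hermitianD(2)[OF J]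
    note J_lin = bounded_clinearD[OF Jb]
    define D where "D x = J x - Q (J (P x))" for x
    have QJP: "hermitian (Q \<circ> J \<circ> P)"
      unfolding comp_def
      by (rule hermitianI, intro PQ_intros bounded_clinear_compose[OF Jb]) (simp add: QP Jsa PQ)
    have le_iff: "Q \<circ> J \<circ> P \<le>\<^sub>L J \<longleftrightarrow> (\<forall>x. 0 \<le> inner (D x) x)"
      by (simp add: loewner_le_hermitian_iff QJP J D_def inner_diff_left)
    have D_eq: "D x = J (x - P x)" if "\<forall>x. J (P x) = Q (J x)" for x
      using that idem by (metis D_def J_lin(6))
    have "\<forall>x. J (P x) = Q (J x)" if pos: "\<forall>x. 0 \<le> inner (D x) x"
    proof
      fix x
      have "linear D"
        unfolding D_def by (intro bounded_clinearD(2) PQ_intros bounded_clinear_compose[OF Jb])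
      moreover have "inner (D (P x)) (P x) = 0" for x
        by (simp add: D_def inner_diff_left QP idem)
      moreover have "inner (D x) y = inner x (D y)" for x y
        by (simp add: D_def inner_diff_left inner_diff_right QP Jsa PQ)
      ultimately have "D (P x) = 0" for x using pos by (intro positive_form_eq_0[of D]) auto
      then have JP: "J (P x) = Q (J (P x))" for x by (simp add: D_def idem)
      show "J (P x) = Q (J x)"
      proof (rule vector_eq_ldot[THEN iffD1], rule allI)
        fix y
        have "inner y (J (P x)) = inner y (Q (J (P x)))" by (simp flip: JP)
        also have "\<dots> = inner (Q (J (P y))) x" by (simp add: QP PQ[symmetric] Jsa)
        also have "\<dots> = inner (J (P y)) x" by (simp flip: JP)
        also have "\<dots> = inner y (Q (J x))" by (simp add: Jsa PQ)
        finally show "inner y (J (P x)) = inner y (Q (J x))" .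
      qed
    qed
    then show ?thesis unfolding le_iff using D_eq by metis
  qed
  then show ?thesis by (auto simp: symmetry_iff admissible_def)
qed

text \<open>Conjugation by \<open>J\<close> exchanges \<open>P\<close> and \<open>Q\<close>, so the
  facts about \<open>P\<close> transfer to \<open>Q\<close>; positivity is evaluated at
  \<open>J x\<close>.\<close>

lemma admissibleD:
  assumes "admissible J"
  shows "hermitian J" "J (J x) = x" "J (P x) = Q (J x)" "0 \<le> inner (J (x - P x)) x"
    "J (Q x) = P (J x)" "0 \<le> inner (J (x - Q x)) x"
proof -
  show *: "hermitian J" "J (J x) = x" "J (P x) = Q (J x)" "0 \<le> inner (J (x - P x)) x" for x
    using assms by (auto simp: admissible_def)
  show **: "J (Q x) = P (J x)" for x by (metis *(2,3))
  have "inner (J (x - Q x)) x = inner (J (J x - P (J x))) (J x)"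
    using hermitianD(1)[OF *(1)] hermitianD(2)[OF *(1), of "J x - P (J x)" "J x"]
    by (simp add: bounded_clinearD * **)
  also have "\<dots> \<ge> 0" by (rule *(4))
  finally show "0 \<le> inner (J (x - Q x)) x" .
qed

section \<open>The subspace on which admissible symmetries differ\<close>

text \<open>This is \<open>2 I - (P + Q)\<close>, grouped as the complementary idempotent plus its
  adjoint so that \<open>sum_eq_0D\<close> applies to it.\<close>

definition "G x = x - P x + (x - Q x)"

lemma bounded_clinear_G: "bounded_clinear G"
  unfolding G_def by (intro PQ_intros)

text \<open>By \<open>null_space_G\<close> this projects onto the intersection of R(P) and
  R(Q).\<close>

definition "K = orth_proj (null_space G)"

lemma complement_idempotent: "bounded_idempotent (\<lambda>x. x - P x)"
  by unfold_locales (intro PQ_intros, simp add: P_lin idem)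

lemma adj_complement: "adj (\<lambda>x. x - P x) = (\<lambda>x. x - Q x)"
  by (rule adj_eqI, intro PQ_intros) (simp add: inner_diff_left inner_diff_right PQ)

lemma null_space_G:
  "null_space G = {x. P x = x \<and> Q x = x}"
proof -
  have "P x = x \<and> Q x = x" if "x - P x + (x - Q x) = 0" for x
    using bounded_idempotent.sum_eq_0D[OF complement_idempotent, of x] that
    by (simp add: adj_complement)
  then show ?thesis by (auto simp: null_space_def G_def)
qed

lemma
  shows hermitian_K: "hermitian K"
    and K_range: "P (K x) = K x" "Q (K x) = K x"
    and K_fixed: "P x = x \<Longrightarrow> Q x = x \<Longrightarrow> K x = x"
    and K_orth: "P y = y \<Longrightarrow> Q y = y \<Longrightarrow> inner (x - K x) y = 0"
proof -
  note M = csubspace_null_space[OF bounded_clinear_G] closed_null_space[OF bounded_clinear_G]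
  show "hermitian K" unfolding K_def by (rule hermitian_orth_proj[OF M])
  show "P (K x) = K x" "Q (K x) = K x"
    using orth_proj_works(1)[OF M, of x] by (auto simp: null_space_G K_def)
  show "P x = x \<Longrightarrow> Q x = x \<Longrightarrow> K x = x"
    unfolding K_def by (rule orth_proj_ident[OF M(1)]) (simp add: null_space_G)
  show "P y = y \<Longrightarrow> Q y = y \<Longrightarrow> inner (x - K x) y = 0"
    unfolding K_def by (rule orth_proj_works(2)[OF M]) (simp add: null_space_G)
qed

text \<open>\<open>J\<close> exchanges \<open>I - P\<close> and \<open>I - Q\<close>, so it commutes
  with their sum \<open>G\<close>.\<close>

lemma admissible_comp_G:
  assumes J: "admissible J"
  shows "hermitian (\<lambda>x. J (G x))"
    and "0 \<le> inner (J (G x)) x"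
    and "J (G (J (G x))) = G (G x)"
proof -
  note J' = admissibleD[OF J]
  note Jb = hermitianD(1)[OF J'(1)] and Jsa = hermitianD(2)[OF J'(1)]
  note J_lin = bounded_clinearD[OF Jb]
  show "hermitian (\<lambda>x. J (G x))"
  proof (rule hermitianI)
    show "inner (J (G x)) y = inner x (J (G y))" for x y
      by (simp add: G_def J_lin J' inner_simps Jsa PQ QP)
    show "bounded_clinear (\<lambda>x. J (G x))"
      using Jb bounded_clinear_G by (rule bounded_clinear_compose)
  qed
  show "0 \<le> inner (J (G x)) x"
    using J'(4)[of x] J'(6)[of x] by (simp add: G_def J_lin(5) inner_add_left)
  show "J (G (J (G x))) = G (G x)"
    by (simp add: G_def J_lin J' P_lin Q_lin)
qed

text \<open>Uniqueness of the positive square root of \<open>G^2\<close> gives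
  \<open>J G = J0 G\<close>, so \<open>D = J - J0\<close> vanishes on R(G) and, being self-adjoint,
  maps into N(G). Hence \<open>D = K D K\<close>.\<close>

lemma admissible_diff:
  assumes J: "admissible J" and J0: "admissible J0" and J0K: "\<And>x. J0 (K x) = - K x"
  shows "inner (J x - J0 x) x = inner (J (K x)) (K x) + inner (K x) (K x)"
proof -
  note J' = admissibleD[OF J] and J0' = admissibleD[OF J0]
  define D where "D x = J x - J0 x" for x
  have Dsa: "inner (D x) y = inner x (D y)" for x y
    using hermitianD(2)[OF J'(1)] hermitianD(2)[OF J0'(1)] by (simp add: D_def inner_simps)
  have Gsa: "inner (G x) y = inner x (G y)" for x y
    by (simp add: G_def inner_simps PQ QP)
  have "(\<lambda>x. J (G x)) = (\<lambda>x. J0 (G x))"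
    using admissible_comp_G[OF J] admissible_comp_G[OF J0]
    by (intro positive_hermitian_sqrt_unique) simp_all
  then have DG: "D (G x) = 0" for x by (simp add: D_def fun_eq_iff)
  have GD: "G (D x) = 0" for x
  proof -
    have "inner (G (D x)) (G (D x)) = inner x (D (G (G (D x))))" by (simp only: Gsa Dsa)
    then show ?thesis by (simp add: DG)
  qed
  have KD: "K (D x) = D x" for x
  proof -
    have "D x \<in> null_space G" using GD[of x] by (simp add: null_space_def)
    then show ?thesis unfolding null_space_G by (simp add: K_fixed)
  qed
  have Ksa: "inner (K x) y = inner x (K y)" for x y by (rule hermitianD(2)[OF hermitian_K])
  have "inner (D x) x = inner (K (D x)) x" by (simp only: KD)
  also have "\<dots> = inner x (D (K x))" by (simp only: Ksa Dsa)
  also have "\<dots> = inner x (K (D (K x)))" by (simp only: KD)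
  also have "\<dots> = inner (D (K x)) (K x)" by (simp only: Ksa[symmetric] inner_commute)
  also have "\<dots> = inner (J (K x)) (K x) + inner (K x) (K x)"
    by (simp add: D_def J0K inner_add_left)
  finally show ?thesis by (simp add: D_def)
qed

lemma isometric_form_bounds:
  assumes "hermitian J" "\<And>x. J (J x) = x"
  shows "\<bar>inner (J x) x\<bar> \<le> inner x x"
proof -
  have "inner (J x) (J x) = inner x x" using assms by (metis hermitianD(2))
  then have "norm (J x) = norm x" by (simp add: norm_eq_sqrt_inner)
  then show ?thesis
    using Cauchy_Schwarz_ineq2[of "J x" x] by (simp add: power2_norm_eq_inner flip: power2_eq_square)
qed

text \<open>\<open>y = J x - x\<close> lies in N(P) and satisfies \<open>J y = - y\<close>, so
  positivity of \<open>J (I - P)\<close> at \<open>y\<close> forces \<open>y = 0\<close>.\<close>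

lemma admissible_eq_ident:
  assumes J: "admissible J" and x: "P x = 0" "Q x = 0"
  shows "J x = x"
proof -
  note J' = admissibleD[OF J]
  note J_lin = bounded_clinearD[OF hermitianD(1)[OF J'(1)]]
  define y where "y = J x - x"
  have "P y = 0" using J'(5)[of x] x by (simp add: y_def P_lin J_lin)
  moreover have "J y = - y" by (simp add: y_def J_lin J')
  ultimately have "inner y y \<le> 0" using J'(4)[of y] by simp
  then have "y = 0" by (metis inner_eq_zero_iff inner_ge_zero order_antisym)
  then show ?thesis by (simp add: y_def)
qed

text \<open>With \<open>F = P + P\<^sup>* - I\<close> one has \<open>F\<^sup>2 = I + (P - P\<^sup>*)\<^sup>* (P - P\<^sup>*) \<ge> I\<close> and \<open>F P = P\<^sup>* F\<close>,
  so \<open>P\<close> commutes with \<open>F\<^sup>2\<close>, hence with \<open>L = (F\<^sup>2)\<^sup>-\<^sup>1\<^sup>/\<^sup>2\<close>; the minimum is \<open>- F L\<close>.\<close>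

lemma minimal_admissible_exists:
  obtains J where "admissible J" "\<And>x. 0 \<le> inner (- J (P x + Q x)) x" "\<And>x. J (K x) = - K x"
proof -
  define F where "F x = P x + Q x - x" for x
  have Fb: "bounded_clinear F"
    unfolding F_def by (intro PQ_intros)
  note F_lin = bounded_clinearD[OF Fb]
  have Fsa: "inner (F x) y = inner x (F y)" for x y
    by (simp add: F_def inner_simps PQ QP)
  have FP: "F (P x) = Q (P x)" "Q (F x) = Q (P x)" and FQ: "F (Q x) = P (Q x)" "P (F x) = P (Q x)" for x
    by (simp_all add: F_def P_lin Q_lin idem idem_adj)
  have F2: "inner (F x) (F x) = inner x x + inner (P x - Q x) (P x - Q x)" for x
  proof -
    have "inner (P x) (Q x) = inner (P x) x" "inner (Q x) x = inner (P x) x"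
      using PQ[of "P x" x] QP[of x x] by (simp_all add: idem inner_commute)
    then show ?thesis by (simp add: F_def inner_simps inner_commute)
  qed
  obtain k0 where k0: "\<And>x. norm (F x) \<le> norm x * k0" using bounded_linear.bounded[OF F_lin(1)] by auto
  \<comment> \<open>A value of at least 2 keeps \<open>1 / k^2\<close> strictly between 0 and
    1.\<close>
  define k where "k = max k0 2"
  have k: "k > 1" "norm (F x) \<le> norm x * k" for x
    using k0[of x] mult_left_mono[of k0 k "norm x"] by (auto simp: k_def)
  define T where "T x = (1 / k\<^sup>2) *\<^sub>R F (F x)" for x
  define r where "r = sqrt (1 - 1 / k\<^sup>2)"
  have k2: "0 < 1 / k\<^sup>2" "1 / k\<^sup>2 < 1" using k(1) by (simp_all add: one_less_power)
  then have r: "0 \<le> r" "r < 1" by (simp_all add: r_def)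
  have r2: "r\<^sup>2 = 1 - 1 / k\<^sup>2" unfolding r_def using k2 by (intro real_sqrt_pow2) simp
  have Tb: "bounded_clinear T" unfolding T_def by (intro bounded_clinear_intros bounded_clinear_compose[OF Fb])
  have Tsa: "inner (T x) y = inner x (T y)" for x y by (simp add: T_def Fsa)
  \<comment> \<open>\<open>T\<close> lies between \<open>1 / k^2\<close> and \<open>I\<close>, and
    the squared norm of \<open>T x\<close> is at most \<open>inner (T x) x\<close>; so one of the
    two cross terms absorbs it and the other gives the gain \<open>1 / k^2\<close>.\<close>
  have T_near: "norm (x - T x) \<le> r * norm x" for x
  proof -
    have "(norm (x - T x))\<^sup>2 = (norm x)\<^sup>2 - 2 * (1 / k\<^sup>2 * (norm (F x))\<^sup>2)
        + (1 / k\<^sup>2)\<^sup>2 * (norm (F (F x)))\<^sup>2"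
    proof -
      have "inner x (F (F x)) = inner (F x) (F x)" by (simp add: Fsa)
      then show ?thesis
        unfolding T_def power2_norm_eq_inner
        by (simp add: inner_diff_left inner_diff_right inner_commute power2_eq_square)
    qed
    moreover have "(1 / k\<^sup>2)\<^sup>2 * (norm (F (F x)))\<^sup>2 \<le> 1 / k\<^sup>2 * (norm (F x))\<^sup>2"
    proof -
      have "(norm (F (F x)))\<^sup>2 \<le> (norm (F x) * k)\<^sup>2" using k by (intro power_mono) auto
      then have "(1 / k\<^sup>2)\<^sup>2 * (norm (F (F x)))\<^sup>2 \<le> (1 / k\<^sup>2)\<^sup>2 * (norm (F x) * k)\<^sup>2"
        by (intro mult_left_mono) auto
      also have "\<dots> = 1 / k\<^sup>2 * (norm (F x))\<^sup>2"
        using k(1) by (simp add: power_mult_distrib power2_eq_square)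
      finally show ?thesis .
    qed
    moreover have "1 / k\<^sup>2 * (norm x)\<^sup>2 \<le> 1 / k\<^sup>2 * (norm (F x))\<^sup>2"
      using F2[of x] k2 by (intro mult_left_mono) (auto simp: power2_norm_eq_inner)
    ultimately have "(norm (x - T x))\<^sup>2 \<le> (1 - 1 / k\<^sup>2) * (norm x)\<^sup>2"
      unfolding left_diff_distrib by linarith
    also have "\<dots> = (r * norm x)\<^sup>2" by (simp only: power_mult_distrib r2)
    finally show ?thesis by (rule power2_le_imp_le) (simp add: r)
  qed
  obtain L0 where L0: "bounded_linear L0" "\<And>x y. inner (L0 x) y = inner x (L0 y)"
      "\<And>x. 0 \<le> inner (L0 x) x" "\<And>x. L0 (L0 (T x)) = x"
      "\<And>g x. \<lbrakk>bounded_linear g; \<And>x. g (T x) = T (g x)\<rbrakk> \<Longrightarrow> g (L0 x) = L0 (g x)"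
    using inverse_sqrt_exists[OF bounded_clinearD(1)[OF Tb] Tsa r T_near] by blast
  \<comment> \<open>Dividing by \<open>k\<close> undoes the scaling in \<open>T\<close>, so that
    \<open>L^2 F^2 = I\<close>.\<close>
  define L where "L x = (1 / k) *\<^sub>R L0 x" for x
  interpret L0: bounded_linear L0 by (rule L0)
  have L_comm: "g (L x) = L (g x)" if g: "bounded_linear g" "\<And>x. g (F (F x)) = F (F (g x))" for g x
    using L0(5)[OF g(1)] g by (simp add: L_def T_def linear_scale bounded_linear.linear)
  \<comment> \<open>\<open>L0\<close> is obtained as a real-linear map; complex linearity holds
    because complex scalars commute with \<open>F^2\<close>.\<close>
  have "L (c *\<^sub>C x) = c *\<^sub>C L x" for c x
    using L_comm[OF bounded_linear_scaleC, of c x] by (simp add: F_lin)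
  then have Lb: "bounded_clinear L"
    unfolding bounded_clinear_def L_def
    using bounded_linear_const_scaleR[OF L0(1)] by auto
  note L_lin = bounded_clinearD[OF Lb]
  have Lsa: "inner (L x) y = inner x (L y)" for x y by (simp add: L_def L0(2))
  have L_pos: "0 \<le> inner (L x) x" for x using L0(3)[of x] k(1) by (simp add: L_def)
  have LLFF: "L (L (F (F x))) = x" for x
    using L0(4)[of x] by (simp add: L_def T_def L0.scaleR power2_eq_square)
  have FL: "F (L x) = L (F x)" and PL: "P (L x) = L (P x)" and QL: "Q (L x) = L (Q x)" for x
    by (rule L_comm; simp add: F_lin P_lin Q_lin FP FQ)+
  define J where "J x = - L (F x)" for x
  have Jb: "bounded_clinear J" unfolding J_def by (intro bounded_clinear_intros bounded_clinear_compose[OF Lb] Fb)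
  note J_lin = bounded_clinearD[OF Jb]
  have J: "admissible J"
    unfolding admissible_def
  proof (intro conjI allI)
    show "hermitian J" by (rule hermitianI[OF Jb]) (simp add: J_def Lsa Fsa FL)
    show "J (J x) = x" for x by (simp add: J_def F_lin L_lin FL LLFF)
    show "J (P x) = Q (J x)" for x by (simp add: J_def FP QL Q_lin)
    \<comment> \<open>The factorisation \<open>J (I - P) = (I - Q) L (I - P)\<close> reduces the
      form to that of \<open>L\<close> at \<open>x - P x\<close>.\<close>
    have "J (x - P x) = x' - Q x'" if "x' = L (x - P x)" for x x'
      by (simp add: that J_def QL FP F_lin L_lin P_lin Q_lin) (simp add: F_def L_lin algebra_simps)
    then have "inner (J (x - P x)) x = inner (L (x - P x)) (x - P x)" for x
      by (simp add: inner_diff_left inner_diff_right QP)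
    then show "0 \<le> inner (J (x - P x)) x" for x by (simp add: L_pos)
  qed
  have JA_pos: "0 \<le> inner (- J (P x + Q x)) x" for x
  proof -
    \<comment> \<open>Here \<open>- J (P + Q) = Q L P + P L Q\<close>.\<close>
    have "inner (- J (P x + Q x)) x = inner (L (P x)) (P x) + inner (L (Q x)) (Q x)"
      using PQ[of "L (Q x)" x] QP[of "L (P x)" x]
      by (simp add: J_def F_lin L_lin FP FQ PL QL inner_add_left)
    then show ?thesis by (simp add: L_pos)
  qed
  moreover have "J (K x) = - K x" for x
  proof -
    \<comment> \<open>\<open>J\<close>, \<open>P\<close> and \<open>Q\<close> all fix
      \<open>y\<close>, so the form of \<open>- J (P + Q)\<close> at \<open>y\<close> is
      \<open>- 2 * inner y y\<close>, which forces \<open>y = 0\<close>.\<close>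
    define y where "y = J (K x) + K x"
    have "P y = y" "Q y = y"
      using admissibleD(3)[OF J, of "K x"] admissibleD(5)[OF J, of "K x"]
      by (simp_all add: y_def P_lin Q_lin K_range)
    moreover have "J y = y" by (simp add: y_def J_lin admissibleD(2)[OF J])
    ultimately have "inner y y \<le> 0" using JA_pos[of y] by (simp add: J_lin inner_diff_left)
    then have "y = 0" by (metis inner_eq_zero_iff inner_ge_zero order_antisym)
    then show ?thesis by (simp add: y_def eq_neg_iff_add_eq_0)
  qed
  ultimately show ?thesis using that J by blast
qed

text \<open>\<open>J K = K J = - K\<close> keeps the square equal to \<open>I\<close>,
  \<open>K P = K = Q K\<close> keeps the intertwining relation, and \<open>K (I - P) = 0\<close>
  leaves the positive form unchanged.\<close>

lemma admissible_flip:
  assumes J: "admissible J" and JK: "\<And>x. J (K x) = - K x"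
  shows "admissible (\<lambda>x. J x + 2 *\<^sub>R K x)"
proof -
  note J' = admissibleD[OF J]
  note Jb = hermitianD(1)[OF J'(1)] and Jsa = hermitianD(2)[OF J'(1)]
  note J_lin = bounded_clinearD[OF Jb]
  note Kb = hermitianD(1)[OF hermitian_K] and Ksa = hermitianD(2)[OF hermitian_K]
  note K_lin = bounded_clinearD[OF Kb]
  have KJ: "K (J x) = - K x" for x
    by (rule vector_eq_ldot[THEN iffD1]) (metis JK Jsa Ksa inner_minus_left inner_minus_right)
  have KK: "K (K x) = K x" for x by (simp add: K_fixed K_range)
  have KP: "K (P x) = K x" for x
    by (rule vector_eq_ldot[THEN iffD1]) (metis K_range(2) Ksa QP)
  show ?thesis
    unfolding admissible_def
  proof (intro conjI allI)
    show "hermitian (\<lambda>x. J x + 2 *\<^sub>R K x)"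
      by (rule hermitianI, intro bounded_clinear_intros Jb Kb) (simp add: inner_simps Jsa Ksa)
    show "J (J x + 2 *\<^sub>R K x) + 2 *\<^sub>R K (J x + 2 *\<^sub>R K x) = x" for x
      by (simp add: J_lin K_lin J' JK KJ KK scaleR_2)
    show "J (P x) + 2 *\<^sub>R K (P x) = Q (J x + 2 *\<^sub>R K x)" for x
      by (simp add: J' KP Q_lin K_range)
    show "0 \<le> inner (J (x - P x) + 2 *\<^sub>R K (x - P x)) x" for x
      using J'(4)[of x] by (simp add: K_lin KP)
  qed
qed

section \<open>Identification with the projection formulas\<close>

text \<open>\<open>J\<close> commutes with \<open>P + Q\<close> because it exchanges the summands,
  so \<open>- J (P + Q)\<close> squares to \<open>(P + Q)^2\<close>.\<close>

lemma op_abs_eq: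
  assumes J: "admissible J" and pos: "\<And>x. 0 \<le> inner (- J (P x + Q x)) x"
  shows "op_abs (\<lambda>x. P x + Q x) = (\<lambda>x. - J (P x + Q x))"
proof (rule op_abs_eqI)
  note J' = admissibleD[OF J]
  note Jb = hermitianD(1)[OF J'(1)] and Jsa = hermitianD(2)[OF J'(1)]
  note J_lin = bounded_clinearD[OF Jb]
  show "hermitian (\<lambda>x. - J (P x + Q x))"
    by (rule hermitianI, intro PQ_intros bounded_clinear_compose[OF Jb])
      (simp add: J_lin inner_simps J' QP PQ Jsa)
  show "hermitian (\<lambda>x. P x + Q x)"
    by (rule hermitianI, intro PQ_intros) (simp add: inner_simps QP PQ)
  show "- J (P (- J (P x + Q x)) + Q (- J (P x + Q x))) = P (P x + Q x) + Q (P x + Q x)" for x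
    by (simp add: P_lin Q_lin J_lin J' idem idem_adj)
qed (rule pos)

text \<open>With \<open>R = (I + J) / 2\<close>, the projection onto the fixed vectors of
  \<open>J\<close>, the negative part of \<open>A\<close> is \<open>- R A\<close>. As
  \<open>R\<close> fixes N(A), its range projection is \<open>R - Z\<close>, and
  \<open>2 (R - Z) - I + 2 Z = J\<close>.\<close>

lemma neg_part_range_proj:
  assumes J: "admissible J" and pos: "\<And>x. 0 \<le> inner (- J (P x + Q x)) x"
  shows "2 *\<^sub>R range_proj (neg_part (\<lambda>v. P v + Q v)) x - x
    + 2 *\<^sub>R orth_proj (null_space (\<lambda>v. P v + Q v)) x = J x"
proof -
  note J' = admissibleD[OF J]
  note Jb = hermitianD(1)[OF J'(1)] and Jsa = hermitianD(2)[OF J'(1)]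
  note J_lin = bounded_clinearD[OF Jb]
  define A where "A x = P x + Q x" for x
  define N where "N = neg_part A"
  define Z where "Z = orth_proj (null_space A)"
  define R where "R x = (1/2) *\<^sub>R (x + J x)" for x
  have A: "hermitian A"
    unfolding A_def by (rule hermitianI, intro PQ_intros) (simp add: inner_simps QP PQ)
  have Ab: "bounded_clinear A" by (rule hermitianD(1)[OF A])
  note A_lin = bounded_clinearD[OF Ab]
  have N: "N x = - R (A x)" for x
  proof -
    have "op_abs A = (\<lambda>x. - J (A x))" unfolding A_def by (rule op_abs_eq[OF J pos])
    then show ?thesis
      unfolding N_def neg_part_def R_def
      by (simp only: inverse_eq_divide scaleR_diff_right scaleR_add_right scaleR_minus_right) simp
  qed
  have Nb: "bounded_clinear N"
    unfolding N R_def by (intro bounded_clinear_intros bounded_clinear_compose[OF Jb] Ab)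
  have Rsa: "inner (R x) y = inner x (R y)" for x y by (simp add: R_def inner_simps Jsa)
  have RR: "R (R x) = R x" for x
    by (simp add: R_def J_lin J' algebra_simps flip: scaleR_add_left)
  have Rb: "bounded_clinear R" unfolding R_def by (intro bounded_clinear_intros Jb)
  note R_lin = bounded_clinearD[OF Rb]
  note Zw = orth_proj_works[OF csubspace_null_space[OF Ab] closed_null_space[OF Ab]]
  have AZ: "A (Z x) = 0" for x using Zw(1)[of x] by (simp add: Z_def null_space_def)
  have RZ: "R (Z x) = Z x" for x
  proof -
    have "P (Z x) = 0" "Q (Z x) = 0" using AZ[of x] sum_eq_0D by (auto simp: A_def)
    then have "J (Z x) = Z x" by (rule admissible_eq_ident[OF J])
    then show ?thesis by (simp add: R_def flip: scaleR_2)
  qed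
  have "range_proj N x = R x - Z x"
    unfolding range_proj_def
  proof (rule orth_proj_eqI[OF csubspace_closure_range[OF Nb]])
    have "x - Z x \<in> closure (range A)"
      by (rule orth_null_space_closure_range[OF A]) (use Zw(2) in \<open>auto simp: Z_def null_space_def\<close>)
    moreover have "R ` closure (range A) \<subseteq> closure (range N)"
    proof (rule image_closure_subset)
      show "R ` range A \<subseteq> closure (range N)"
      proof clarify
        fix u
        have "R (A u) = N (- u)" by (simp add: N A_lin R_lin)
        then show "R (A u) \<in> closure (range N)" by (simp add: closure_subset[THEN subsetD])
      qed
    qed (auto intro: linear_continuous_on R_lin)
    ultimately have "R (x - Z x) \<in> closure (range N)" by blast
    then show "R x - Z x \<in> closure (range N)" by (simp add: R_lin RZ)
    show "inner (x - (R x - Z x)) z = 0" if z: "z \<in> closure (range N)" for z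
    proof -
      have "inner (x - (R x - Z x)) (N u) = 0" for u
      proof -
        have "inner (x - (R x - Z x)) (N u) = - inner (A (R (x - (R x - Z x)))) u"
          by (simp add: N hermitianD(2)[OF A] Rsa)
        also have "R (x - (R x - Z x)) = Z x" by (simp add: R_lin RR RZ)
        finally show ?thesis by (simp add: AZ)
      qed
      then have "closure (range N) \<subseteq> {z. inner (x - (R x - Z x)) z = 0}"
        by (intro closure_minimal closed_Collect_eq continuous_intros) auto
      then show ?thesis using z by blast
    qed
  qed
  then have "2 *\<^sub>R range_proj N x - x + 2 *\<^sub>R Z x = J x"
    by (simp add: scaleR_diff_right) (simp add: R_def)
  then show ?thesis unfolding N_def Z_def A_def .
qed

text \<open>A vector with \<open>P v = Q v\<close> splits into \<open>v - P v\<close> in N(P + Q)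
  and \<open>P v\<close> in the intersection of R(P) and R(Q); the residual is tested on each
  piece.\<close>

lemma orth_proj_null_diff:
  "orth_proj (null_space (\<lambda>v. P v - Q v)) x = orth_proj (null_space (\<lambda>v. P v + Q v)) x + K x"
proof (rule orth_proj_eqI)
  define Z where "Z = orth_proj (null_space (\<lambda>v. P v + Q v))"
  have Ab: "bounded_clinear (\<lambda>v. P v + Q v)" by (intro PQ_intros)
  note Zw = orth_proj_works[OF csubspace_null_space[OF Ab] closed_null_space[OF Ab]]
  have "P (Z x) + Q (Z x) = 0" using Zw(1)[of x] by (simp add: Z_def null_space_def)
  note PZ = sum_eq_0D[OF this]
  show "csubspace (null_space (\<lambda>v. P v - Q v))"
    by (intro csubspace_null_space PQ_intros)
  show "orth_proj (null_space (\<lambda>v. P v + Q v)) x + K x \<in> null_space (\<lambda>v. P v - Q v)"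
    unfolding Z_def[symmetric] by (simp add: null_space_def P_lin Q_lin K_range PZ)
  show "inner (x - (orth_proj (null_space (\<lambda>v. P v + Q v)) x + K x)) v = 0"
    if v: "v \<in> null_space (\<lambda>v. P v - Q v)" for v
  proof -
    have Qv: "Q v = P v" using v by (simp add: null_space_def)
    have QPv: "Q (P v) = P v" using idem_adj[of v] by (simp add: Qv)
    have "inner (x - Z x) (v - P v) = 0"
      unfolding Z_def by (rule Zw(2)) (simp add: null_space_def P_lin Q_lin idem Qv QPv)
    moreover have "inner (K x) (v - P v) = 0"
      using PQ[of "K x" "v - P v"] by (simp add: K_range Q_lin Qv QPv)
    moreover have "inner (x - K x) (P v) = 0" by (rule K_orth) (simp_all add: idem QPv)
    moreover have "inner (Z x) (P v) = 0" using QP[of "Z x" v] by (simp add: PZ)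
    ultimately show ?thesis
      unfolding Z_def[symmetric] by (simp add: inner_simps)
  qed
qed

end

theorem theorem7:
  fixes P :: "'a::chilbert_space \<Rightarrow> 'a"
  assumes "separable_space (euclidean :: 'a topology)"
    and "bounded_clinear P"
    and "P \<circ> P = P"
  shows "loewner_min {J. symmetry J \<and> adj P \<circ> J \<circ> P \<le>\<^sub>L J}
           (\<lambda>x. 2 *\<^sub>R range_proj (neg_part (\<lambda>v. P v + adj P v)) x - x
                + 2 *\<^sub>R orth_proj (null_space (\<lambda>v. P v + adj P v)) x)
       \<and> loewner_max {J. symmetry J \<and> adj P \<circ> J \<circ> P \<le>\<^sub>L J}
           (\<lambda>x. 2 *\<^sub>R range_proj (neg_part (\<lambda>v. P v + adj P v)) x - x
                + 2 *\<^sub>R orth_proj (null_space (\<lambda>v. P v - adj P v)) x)"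
proof -
  interpret bounded_idempotent P
    using assms(2,3) by unfold_locales (auto simp: fun_eq_iff)
  obtain J0 where J0: "admissible J0" "\<And>x. 0 \<le> inner (- J0 (P x + adj P x)) x"
      "\<And>x. J0 (K x) = - K x"
    using minimal_admissible_exists by blast
  define J1 where "J1 x = J0 x + 2 *\<^sub>R K x" for x
  have J1: "admissible J1" unfolding J1_def by (rule admissible_flip[OF J0(1,3)])
  note min_eq = neg_part_range_proj[OF J0(1,2)]
  have max_eq: "2 *\<^sub>R range_proj (neg_part (\<lambda>v. P v + adj P v)) x - x
      + 2 *\<^sub>R orth_proj (null_space (\<lambda>v. P v - adj P v)) x = J1 x" for x
    using min_eq[of x] by (simp add: J1_def orth_proj_null_diff scaleR_add_right)
  have "J0 \<le>\<^sub>L J \<and> J \<le>\<^sub>L J1" if J: "admissible J" for J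
  proof -
    have herm: "hermitian J" "hermitian J0" "hermitian J1"
      using J J0(1) J1 by (auto dest: admissibleD)
    have "inner (J0 x) x \<le> inner (J x) x \<and> inner (J x) x \<le> inner (J1 x) x" for x
    proof -
      \<comment> \<open>By \<open>admissible_diff\<close> the form of \<open>J - J0\<close> at
        \<open>x\<close> then lies between 0 and \<open>2 * inner (K x) (K x)\<close>, which is the
        form of \<open>J1 - J0\<close>.\<close>
      have "\<bar>inner (J (K x)) (K x)\<bar> \<le> inner (K x) (K x)"
        using herm(1) admissibleD(2)[OF J] by (rule isometric_form_bounds)
      moreover have "inner (K x) x = inner (K x) (K x)"
        using hermitianD(2)[OF hermitian_K, of "K x" x] by (simp add: K_fixed K_range)
      ultimately show ?thesis
        using admissible_diff[OF J J0(1,3), of x]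
        unfolding J1_def inner_add_left inner_diff_left inner_scaleR_left by linarith
    qed
    then show ?thesis using herm by (simp add: loewner_le_hermitian_iff)
  qed
  then show ?thesis
    unfolding loewner_min_def loewner_max_def symmetry_le_iff_admissible min_eq max_eq
    using J0(1) J1 by simp
qed

end
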